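(* Let $q\geq 11$ be a prime power with $q\equiv 3\pmod{4}$ and $p=\operatorname{char}(\mathbb{F}_q)>3$. There exists a smooth blocking plane curve over $\mathbb{F}_q$ with degree $d=\frac{q-1}{2}$.
   Context: A plane curve $C=\{F=0\}\subset\mathbb{P}^2$ of degree $d$ over $\mathbb{F}_q$ is given by a nonzero homogeneous polynomial $F\in\mathbb{F}_q[x,y,z]$ of degree $d$. It is smooth if at every point $P\in C$ (over $\overline{\mathbb{F}_q}$) at least one of the partial derivatives $F_x,F_y,F_z$ does not vanish. $C(\mathbb{F}_q)$ is the set of points $[x:y:z]\in\mathbb{P}^2(\mathbb{F}_q)$ with $F(x,y,z)=0$. A set $B\subseteq\mathbb{P}^2(\mathbb{F}_q)$ is a blocking set if every line of $\mathbb{P}^2$ defined over $\mathbb{F}_q$ (an $\mathbb{F}_q$-line) contains a point of $B$. The curve $C$ is blocking (over $\mathbb{F}_q$) if $C(\mathbb{F}_q)$ is a blocking set. *)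

theory Defs
  imports
    "HOL-Analysis.Finite_Cartesian_Product"
    "HOL-Library.Poly_Mapping"
    "HOL-Library.Numeral_Type"
    "HOL-Number_Theory.Prime_Powers"
    "HOL-Algebra.Algebraic_Closure_Type"
begin

text \<open>
  Polynomials in three variables: the variables are indexed by the three-element type \<open>3\<close>,
  a monomial is its exponent vector, and a polynomial is a finitely supported family of
  coefficients. Since \<open>3 = 0\<close> in that type, the coordinates of a vector \<open>v\<close> are
  \<open>v $ 1\<close>, \<open>v $ 2\<close> and \<open>v $ 3\<close>, as usual.
\<close>

type_synonym 'a poly3 = "(3 \<Rightarrow>\<^sub>0 nat) \<Rightarrow>\<^sub>0 'a"

definition eval3 :: "'a::comm_semiring_1 poly3 \<Rightarrow> 'a ^ 3 \<Rightarrow> 'a" where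
  "eval3 F v =
     (\<Sum>m\<in>Poly_Mapping.keys F.
        Poly_Mapping.lookup F m * (\<Prod>i\<in>UNIV. (v $ i) ^ Poly_Mapping.lookup m i))"

text \<open>
  Formal partial derivative. The truncated subtraction is harmless: if variable \<open>i\<close> does not
  occur in \<open>m\<close>, the new coefficient is \<open>0\<close>.
\<close>

definition partial3 :: "3 \<Rightarrow> 'a::comm_semiring_1 poly3 \<Rightarrow> 'a poly3" where
  "partial3 i F =
     (\<Sum>m\<in>Poly_Mapping.keys F.
        Poly_Mapping.single (m - Poly_Mapping.single i 1)
          (of_nat (Poly_Mapping.lookup m i) * Poly_Mapping.lookup F m))"

definition homogeneous3 :: "nat \<Rightarrow> 'a::zero poly3 \<Rightarrow> bool" where
  "homogeneous3 d F \<longleftrightarrow>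
     (\<forall>m\<in>Poly_Mapping.keys F. (\<Sum>i\<in>UNIV. Poly_Mapping.lookup m i) = d)"

definition plane_curve :: "nat \<Rightarrow> 'a::zero poly3 \<Rightarrow> bool" where
  "plane_curve d F \<longleftrightarrow> F \<noteq> 0 \<and> homogeneous3 d F"

definition proj_rel :: "('a::field ^ 3) rel" where
  "proj_rel = {(v, w). v \<noteq> 0 \<and> w \<noteq> 0 \<and> (\<exists>c. c \<noteq> 0 \<and> w = c *s v)}"

definition proj_plane :: "('a::field ^ 3) set set" where
  "proj_plane = {v. v \<noteq> 0} // proj_rel"

text \<open>
  The next two sets ask for vanishing at all representatives of a point; for homogeneous
  polynomials and linear forms this is the same as vanishing at one of them.
\<close>

definition curve_points :: "'a::field poly3 \<Rightarrow> ('a ^ 3) set set" where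
  "curve_points F = {P \<in> proj_plane. \<forall>v\<in>P. eval3 F v = 0}"

definition proj_line :: "'a::field ^ 3 \<Rightarrow> ('a ^ 3) set set" where
  "proj_line a = {P \<in> proj_plane. \<forall>v\<in>P. (\<Sum>i\<in>UNIV. a $ i * v $ i) = 0}"

definition blocking_set :: "('a::field ^ 3) set set \<Rightarrow> bool" where
  "blocking_set B \<longleftrightarrow>
     B \<subseteq> proj_plane \<and> (\<forall>a. a \<noteq> 0 \<longrightarrow> (\<exists>P\<in>B. P \<in> proj_line a))"

definition blocking_curve :: "'a::field poly3 \<Rightarrow> bool" where
  "blocking_curve F \<longleftrightarrow> blocking_set (curve_points F)"

definition to_ac_poly3 :: "'a::field poly3 \<Rightarrow> 'a alg_closure poly3" where
  "to_ac_poly3 F = Poly_Mapping.map to_ac F"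

text \<open>
  Smoothness is tested at the points over the algebraic closure. The partial derivatives are
  homogeneous (possibly zero), so \<open>P \<notin> curve_points (partial3 i G)\<close> means that the
  \<open>i\<close>-th one does not vanish at \<open>P\<close>.
\<close>

definition smooth_curve :: "'a::field poly3 \<Rightarrow> bool" where
  "smooth_curve F \<longleftrightarrow>
     (let G = to_ac_poly3 F
      in \<forall>P\<in>curve_points G. \<exists>i. P \<notin> curve_points (partial3 i G))"

end

(*
  With d = (q - 1) / 2, consider the curve x^d + y^d + z^d = 3 x^2 y^2 z^(d - 4). Since d is odd,
  -1 is not a square in F_q, and u^d is 1 or -1 for every nonzero u in F_q.

  Blocking: the line a x + b y + c z = 0 contains (0 : c : -b), or (0 : 1 : -1) if b = c = 0, and
  this point is on the curve if b^d = c^d; likewise for the other pairs. This leaves the lines through exactly one vertex of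
  the coordinate triangle, with slope s satisfying s^d = 1: y = s z, z = s x and x = s y. They
  contain the points (1/s : s : 1), (1 : s^2 : s) and (s : 1 : r) with r^2 = s and r^d = 1, at
  which all four monomials take the value 1.

  Smoothness: put M = x^2 y^2 z^(d - 4). As 2 d = -1 in F_q, vanishing of the partial derivatives
  gives x^d = y^d = -12 M and z^d = 27 M. Taking d-th powers in M z^4 = x^2 y^2 z^d yields
  27^4 = 12^4 27^d with 27^d = 1 or -1, hence 9^8 = 4^8. But 9^8 - 4^8 is a product of sums of two
  squares, which do not vanish since -1 is not a square.
*)
theory Submission
  imports Defs "HOL-Analysis.Cartesian_Space" "HOL-Number_Theory.Residues"
begin

subsection \<open>Polynomials in three variables\<close>

text \<open>Cancellation can make the keys of \<open>F + G\<close> fewer than the union of both key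
  sets. Because \<open>f m 0 = 0\<close>, all three sums may run over that union, where additivity
  is termwise.\<close>

lemma sum_keys_add:
  fixes F G :: "'k \<Rightarrow>\<^sub>0 'b::comm_monoid_add" and f :: "'k \<Rightarrow> 'b \<Rightarrow> 'c::comm_monoid_add"
  assumes "\<And>m. f m 0 = 0" and "\<And>m a b. f m (a + b) = f m a + f m b"
  shows "(\<Sum>m\<in>Poly_Mapping.keys (F + G). f m (Poly_Mapping.lookup (F + G) m)) =
    (\<Sum>m\<in>Poly_Mapping.keys F. f m (Poly_Mapping.lookup F m)) +
    (\<Sum>m\<in>Poly_Mapping.keys G. f m (Poly_Mapping.lookup G m))"
proof -
  define K where "K = Poly_Mapping.keys F \<union> Poly_Mapping.keys G"
  have *: "(\<Sum>m\<in>Poly_Mapping.keys H. f m (Poly_Mapping.lookup H m)) =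
      (\<Sum>m\<in>K. f m (Poly_Mapping.lookup H m))" if "Poly_Mapping.keys H \<subseteq> K" for H
    by (rule sum.mono_neutral_left)
       (use that assms(1) in \<open>auto simp: K_def in_keys_iff\<close>)
  have "Poly_Mapping.keys (F + G) \<subseteq> K"
    unfolding K_def by (rule Poly_Mapping.keys_add)
  then show ?thesis
    by (subst (1 2 3) *) (auto simp: K_def lookup_add assms(2) sum.distrib)
qed

lemma eval3_add: "eval3 (F + G) v = eval3 F v + eval3 G v"
  unfolding eval3_def
  by (rule sum_keys_add[where f = "\<lambda>m a. a * (\<Prod>i\<in>UNIV. (v $ i) ^ Poly_Mapping.lookup m i)"])
     (simp_all add: distrib_right)

lemma partial3_add: "partial3 i (F + G) = partial3 i F + partial3 i G"
  unfolding partial3_def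
  by (rule sum_keys_add[where f = "\<lambda>m a. Poly_Mapping.single (m - Poly_Mapping.single i 1)
          (of_nat (Poly_Mapping.lookup m i) * a)"])
     (simp_all add: distrib_left single_add)

lemma to_ac_poly3_add: "to_ac_poly3 (F + G) = to_ac_poly3 F + to_ac_poly3 G"
  unfolding to_ac_poly3_def
  by (rule poly_mapping_eqI)
     (simp add: Poly_Mapping.map.rep_eq lookup_add when_def flip: to_ac_add)

lemma eval3_single:
  "eval3 (Poly_Mapping.single m a) v = a * (\<Prod>i\<in>UNIV. (v $ i) ^ Poly_Mapping.lookup m i)"
  by (simp add: eval3_def)

lemma partial3_single:
  "partial3 i (Poly_Mapping.single m a) =
    Poly_Mapping.single (m - Poly_Mapping.single i 1) (of_nat (Poly_Mapping.lookup m i) * a)"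
  by (simp add: partial3_def)

lemma to_ac_poly3_single:
  "to_ac_poly3 (Poly_Mapping.single m a) = Poly_Mapping.single m (to_ac a)"
  by (simp add: to_ac_poly3_def)

lemma eval3_scale:
  assumes "homogeneous3 d F"
  shows "eval3 F (c *s v) = c ^ d * eval3 F v"
proof -
  have "(\<Prod>i\<in>UNIV. ((c *s v) $ i) ^ Poly_Mapping.lookup m i) =
      c ^ d * (\<Prod>i\<in>UNIV. (v $ i) ^ Poly_Mapping.lookup m i)"
    if "m \<in> Poly_Mapping.keys F" for m
    using assms that
    by (simp add: homogeneous3_def power_mult_distrib prod.distrib flip: power_sum)
  then show ?thesis
    by (simp add: eval3_def sum_distrib_left mult.left_commute)
qed

definition mono3 :: "nat \<Rightarrow> nat \<Rightarrow> nat \<Rightarrow> 3 \<Rightarrow>\<^sub>0 nat" where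
  "mono3 a b c = Poly_Mapping.single 1 a + Poly_Mapping.single 2 b + Poly_Mapping.single 3 c"

lemma lookup_mono3 [simp]:
  "Poly_Mapping.lookup (mono3 a b c) 1 = a"
  "Poly_Mapping.lookup (mono3 a b c) 2 = b"
  "Poly_Mapping.lookup (mono3 a b c) 3 = c"
  by (simp_all add: mono3_def lookup_add lookup_single)

lemma prod_UNIV_3: "prod f (UNIV :: 3 set) = f 1 * f 2 * f 3"
  unfolding UNIV_3 by (simp add: ac_simps)

subsection \<open>Points of the projective plane\<close>

lemma proj_rel_refl: "v \<noteq> 0 \<Longrightarrow> (v, v) \<in> proj_rel"
  by (auto simp: proj_rel_def intro: exI[of _ 1])

lemma proj_class_in_plane: "v \<noteq> 0 \<Longrightarrow> proj_rel `` {v} \<in> proj_plane"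
  by (auto simp: proj_plane_def intro: quotientI)

lemma proj_class_in_curve_points:
  assumes "homogeneous3 d F" and "v \<noteq> 0" and "eval3 F v = 0"
  shows "proj_rel `` {v} \<in> curve_points F"
  using assms proj_class_in_plane[of v]
  by (auto simp: curve_points_def proj_rel_def eval3_scale)

lemma proj_class_in_line:
  fixes a v :: "'a::field ^ 3"
  assumes "v \<noteq> 0" and "(\<Sum>i\<in>UNIV. a $ i * v $ i) = 0"
  shows "proj_rel `` {v} \<in> proj_line a"
proof -
  have "(\<Sum>i\<in>UNIV. a $ i * (c *s v) $ i) = c * (\<Sum>i\<in>UNIV. a $ i * v $ i)" for c
    by (simp add: sum_distrib_left mult.left_commute)
  then show ?thesis
    using assms proj_class_in_plane[of v] by (auto simp: proj_line_def proj_rel_def)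
qed

lemma blocking_curveI:
  fixes F :: "'a::field poly3"
  assumes "homogeneous3 d F"
    and "\<And>a :: 'a ^ 3. a \<noteq> 0 \<Longrightarrow> \<exists>v. v \<noteq> 0 \<and> eval3 F v = 0 \<and> (\<Sum>i\<in>UNIV. a $ i * v $ i) = 0"
  shows "blocking_curve F"
  unfolding blocking_curve_def blocking_set_def
proof (intro conjI allI impI)
  show "curve_points F \<subseteq> proj_plane"
    by (auto simp: curve_points_def)
  show "\<exists>P\<in>curve_points F. P \<in> proj_line a" if "a \<noteq> 0" for a
    using assms(2)[OF that] proj_class_in_curve_points[OF assms(1)] proj_class_in_line by blast
qed

text \<open>Asking for a nonzero gradient at every nonzero vector loses nothing for the curve below:
  its degree is invertible in the field, so by Euler's formula common zeros of the partial
  derivatives lie on the curve.\<close>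

lemma smooth_curveI:
  assumes "\<And>v. v \<noteq> 0 \<Longrightarrow> \<exists>i. eval3 (partial3 i (to_ac_poly3 F)) v \<noteq> 0"
  shows "smooth_curve F"
  unfolding smooth_curve_def Let_def
proof
  fix P assume "P \<in> curve_points (to_ac_poly3 F)"
  then obtain v where "v \<noteq> 0" "v \<in> P"
    by (auto simp: curve_points_def proj_plane_def elim!: quotientE intro: proj_rel_refl)
  then show "\<exists>i. P \<notin> curve_points (partial3 i (to_ac_poly3 F))"
    using assms[of v] by (auto simp: curve_points_def)
qed

subsection \<open>The curve\<close>

text \<open>The coefficient -3 puts every point at which all four monomials equal 1 on the
  curve.\<close>

definition blocking_poly :: "nat \<Rightarrow> 'a::comm_ring_1 poly3" where
  "blocking_poly d =
     Poly_Mapping.single (mono3 d 0 0) 1 + Poly_Mapping.single (mono3 0 d 0) 1 +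
     Poly_Mapping.single (mono3 0 0 d) 1 + Poly_Mapping.single (mono3 2 2 (d - 4)) (-3)"

lemma eval3_blocking_poly:
  "eval3 (blocking_poly d) v =
    (v $ 1) ^ d + (v $ 2) ^ d + (v $ 3) ^ d - 3 * ((v $ 1)\<^sup>2 * (v $ 2)\<^sup>2 * (v $ 3) ^ (d - 4))"
  by (simp add: blocking_poly_def eval3_add eval3_single prod_UNIV_3)

lemma homogeneous3_blocking_poly:
  assumes "4 \<le> d"
  shows "homogeneous3 d (blocking_poly d)"
proof -
  have "Poly_Mapping.keys (blocking_poly d :: 'a poly3) \<subseteq>
      {mono3 d 0 0, mono3 0 d 0, mono3 0 0 d, mono3 2 2 (d - 4)}"
    unfolding blocking_poly_def
    by (intro order.trans[OF Poly_Mapping.keys_add] Un_least) auto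
  with assms show ?thesis
    by (fastforce simp: homogeneous3_def sum_3)
qed

lemma plane_curve_blocking_poly:
  assumes "4 \<le> d"
  shows "plane_curve d (blocking_poly d :: 'a::comm_ring_1 poly3)"
proof -
  have "eval3 (blocking_poly d :: 'a poly3) (vector [1, 0, 0]) = 1"
    using assms by (simp add: eval3_blocking_poly zero_power)
  then have "blocking_poly d \<noteq> (0 :: 'a poly3)"
    by (auto simp: eval3_def)
  with assms show ?thesis
    by (simp add: plane_curve_def homogeneous3_blocking_poly)
qed

lemma to_ac_poly3_blocking_poly: "to_ac_poly3 (blocking_poly d) = blocking_poly d"
  by (simp add: blocking_poly_def to_ac_poly3_add to_ac_poly3_single)

text \<open>Multiplying by the variable restores degree d, so each partial derivative becomes a
  combination of one pure power and \<open>M\<close>, and zero coordinates need no separate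
  treatment.\<close>

lemma eval3_partial3_blocking_poly:
  fixes v :: "'a::comm_ring_1 ^ 3"
  assumes "5 \<le> d"
  defines "M \<equiv> (v $ 1)\<^sup>2 * (v $ 2)\<^sup>2 * (v $ 3) ^ (d - 4)"
  shows "v $ 1 * eval3 (partial3 1 (blocking_poly d)) v = of_nat d * (v $ 1) ^ d - 6 * M"
    and "v $ 2 * eval3 (partial3 2 (blocking_poly d)) v = of_nat d * (v $ 2) ^ d - 6 * M"
    and "v $ 3 * eval3 (partial3 3 (blocking_poly d)) v =
      of_nat d * (v $ 3) ^ d - 3 * (of_nat d - 4) * M"
proof -
  obtain n where d: "d = n + 5"
    using assms(1) by (metis add.commute le_iff_add)
  show "v $ 1 * eval3 (partial3 1 (blocking_poly d)) v = of_nat d * (v $ 1) ^ d - 6 * M"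
    and "v $ 2 * eval3 (partial3 2 (blocking_poly d)) v = of_nat d * (v $ 2) ^ d - 6 * M"
    and "v $ 3 * eval3 (partial3 3 (blocking_poly d)) v =
      of_nat d * (v $ 3) ^ d - 3 * (of_nat d - 4) * M"
    by (simp_all add: d M_def blocking_poly_def partial3_add partial3_single eval3_add eval3_single
        prod_UNIV_3 lookup_minus lookup_single eval_nat_numeral algebra_simps)
qed

section \<open>Quadratic residues in a finite field\<close>

lemma finite_field_power_CARD:
  fixes t :: "'a::{field,finite}"
  shows "t ^ CARD('a) = t"
proof (cases "t = 0")
  case False
  \<comment> \<open>Multiplication by \<open>t\<close> permutes the nonzero elements, so their
    product can be cancelled.\<close>
  have "bij_betw ((*) t) (UNIV - {0}) (UNIV - {0})"
    by (rule bij_betwI[where g = "\<lambda>y. y / t"]) (use False in auto)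
  then have "(\<Prod>y\<in>UNIV - {0}. t * y) = \<Prod>(UNIV - {0})"
    by (rule prod.reindex_bij_betw)
  then have "t ^ (CARD('a) - 1) = 1"
    by (simp add: prod.distrib card_Diff_singleton)
  then show ?thesis
    by (metis mult_1_right power_minus_mult zero_less_card_finite mult.commute)
qed (simp add: zero_power)

text \<open>With q = 2 d + 1, a square root t of -1 would satisfy t^q = (-1)^d t = -t, against t^q =
  t.\<close>

lemma minus_one_not_square:
  fixes t :: "'a::{field,finite}"
  assumes "CARD('a) = 2 * d + 1" and "odd d" and "(2 :: 'a) \<noteq> 0"
  shows "t\<^sup>2 \<noteq> -1"
proof
  assume t: "t\<^sup>2 = -1"
  have "t ^ CARD('a) = t"
    by (rule finite_field_power_CARD)
  moreover have "t ^ CARD('a) = (t\<^sup>2) ^ d * t"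
    by (simp add: assms(1) power_mult)
  moreover have "t \<noteq> 0"
    using t by auto
  ultimately have "(1 :: 'a) = -1"
    using t assms(2) by simp
  then have "(2 :: 'a) = 0"
    by (metis add.right_inverse one_add_one)
  with assms(3) show False ..
qed

lemma sum_of_squares_nonzero:
  fixes a b :: "'a::field"
  assumes "\<And>t :: 'a. t\<^sup>2 \<noteq> -1" and "b \<noteq> 0"
  shows "a\<^sup>2 + b\<^sup>2 \<noteq> 0"
proof
  assume "a\<^sup>2 + b\<^sup>2 = 0"
  then have "(a / b)\<^sup>2 = -1"
    using assms(2) by (simp add: power_divide field_simps eq_neg_iff_add_eq_0)
  with assms(1) show False by blast
qed

text \<open>Dividing c^(2 d + 1) = c by c shows that c^d is a square root of 1.\<close>

lemma power_eq_one_or_minus_one: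
  fixes c :: "'a::{field,finite}"
  assumes "CARD('a) = 2 * d + 1" and "c \<noteq> 0"
  shows "c ^ d = 1 \<or> c ^ d = -1"
proof -
  have "c * (c ^ d)\<^sup>2 = c ^ CARD('a)"
    by (simp add: assms(1) mult.commute flip: power_mult)
  also have "\<dots> = c * 1"
    using finite_field_power_CARD[of c] by simp
  finally have "(c ^ d)\<^sup>2 = 1"
    using assms(2) by simp
  then show ?thesis
    by (simp add: power2_eq_1_iff)
qed

lemma nine_pow8_neq_four_pow8:
  assumes "\<And>t :: 'a::field. t\<^sup>2 \<noteq> -1" and "(2 :: 'a) \<noteq> 0"
  shows "(9 :: 'a) ^ 8 \<noteq> 4 ^ 8"
proof
  have sq: "(a :: 'a)\<^sup>2 + b\<^sup>2 \<noteq> 0" if "b \<noteq> 0" for a b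
    using sum_of_squares_nonzero[OF assms(1) that] .
  have four: "(4 :: 'a) \<noteq> 0" "(16 :: 'a) \<noteq> 0"
    using assms(2) power_not_zero[of "2 :: 'a" 2] power_not_zero[of "2 :: 'a" 4] by simp_all
  assume "(9 :: 'a) ^ 8 = 4 ^ 8"
  then have "(9 :: 'a) ^ 8 - 4 ^ 8 = 0"
    by simp
  \<comment> \<open>Repeated difference of squares; the factors 9 - 4 and 9 + 4 merge into 65 = 8^2
    + 1^2.\<close>
  moreover have "(9 :: 'a) ^ 8 - 4 ^ 8 = (8\<^sup>2 + 1\<^sup>2) * (9\<^sup>2 + 4\<^sup>2) * (81\<^sup>2 + 16\<^sup>2)"
    by simp
  ultimately have "(8\<^sup>2 + 1\<^sup>2 :: 'a) * (9\<^sup>2 + 4\<^sup>2) * (81\<^sup>2 + 16\<^sup>2) = 0"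
    by argo
  moreover have "(8\<^sup>2 + 1\<^sup>2 :: 'a) \<noteq> 0" "(9\<^sup>2 + 4\<^sup>2 :: 'a) \<noteq> 0" "(81\<^sup>2 + 16\<^sup>2 :: 'a) \<noteq> 0"
    by (rule sq, simp add: four)+
  ultimately show False
    by (metis mult_eq_0_iff)
qed

section \<open>Smoothness\<close>

lemma smooth_curve_blocking_poly:
  assumes card: "CARD('a::{field,finite}) = 2 * d + 1" and d: "odd d" "5 \<le> d" and "CHAR('a) > 3"
  shows "smooth_curve (blocking_poly d :: 'a poly3)"
proof (rule smooth_curveI, rule ccontr)
  fix v :: "'a alg_closure ^ 3"
  assume v: "v \<noteq> 0"
    and "\<nexists>i. eval3 (partial3 i (to_ac_poly3 (blocking_poly d))) v \<noteq> 0"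
  then have partial: "eval3 (partial3 i (blocking_poly d)) v = 0" for i
    by (simp add: to_ac_poly3_blocking_poly)
  have two: "(2 :: 'a) \<noteq> 0" and three: "(3 :: 'a) \<noteq> 0"
    using of_nat_eq_0_iff_char_dvd[of 2, where 'a = 'a] of_nat_eq_0_iff_char_dvd[of 3, where 'a = 'a]
      assms(4) by (auto dest: dvd_imp_le)
  have "of_nat (2 * d + 1) = (0 :: 'a alg_closure)"
    unfolding of_nat_eq_0_iff_char_dvd using CHAR_dvd_CARD[where 'a = 'a] by (simp add: card)
  then have two_d: "2 * of_nat d = (-1 :: 'a alg_closure)"
    by (simp add: eq_neg_iff_add_eq_0 add.commute)
  define x y z where "x = v $ 1" and "y = v $ 2" and "z = v $ 3"
  define M where "M = x\<^sup>2 * y\<^sup>2 * z ^ (d - 4)"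
  note xyz = x_def y_def z_def
  \<comment> \<open>Since 2 d = -1, the inverse of d is -2.\<close>
  have elim_d: "u = -2 * w" if "of_nat d * u - w = 0" for u w :: "'a alg_closure"
  proof -
    have "-2 * w = - (2 * of_nat d) * u"
      using that by (simp add: mult.assoc)
    then show ?thesis
      by (simp only: two_d) simp
  qed
  have euler: "of_nat d * x ^ d - 6 * M = 0" "of_nat d * y ^ d - 6 * M = 0"
    "of_nat d * z ^ d - 3 * (of_nat d - 4) * M = 0"
    by (simp_all only: M_def xyz eval3_partial3_blocking_poly[OF d(2), symmetric] partial
        mult_zero_right)
  have xd: "x ^ d = -12 * M" and yd: "y ^ d = -12 * M"
    using elim_d[OF euler(1)] elim_d[OF euler(2)] by simp_all
  \<comment> \<open>The factor is -2 times the -3 (d - 4) of the third relation, up to sign: -6 (d -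
    4) = 24 - 3 (2 d).\<close>
  have "z ^ d = (24 - 3 * (2 * of_nat d)) * M"
    using elim_d[OF euler(3)] by (simp add: algebra_simps)
  then have zd: "z ^ d = 27 * M"
    by (simp only: two_d) simp
  have "M \<noteq> 0"
  proof
    assume "M = 0"
    with xd yd zd have "x = 0" "y = 0" "z = 0"
      by auto
    with v show False
      by (simp add: vec_eq_iff forall_3 xyz)
  qed
  have "z ^ d = z ^ (d - 4) * z ^ 4"
    using d(2) by (simp flip: power_add)
  then have "M * z ^ 4 = x\<^sup>2 * y\<^sup>2 * z ^ d"
    by (simp add: M_def)
  then have "(M * z ^ 4) ^ d = (x\<^sup>2 * y\<^sup>2 * z ^ d) ^ d"
    by simp
  then have "M ^ d * (z ^ d) ^ 4 = (x ^ d)\<^sup>2 * (y ^ d)\<^sup>2 * (z ^ d) ^ d"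
    by (simp add: power_mult_distrib mult.commute flip: power_mult)
  \<comment> \<open>Both sides have degree d + 4 in \<open>M\<close>, so cancelling leaves an
    identity between constants.\<close>
  then have "M ^ d * M ^ 4 * 27 ^ 4 = M ^ d * M ^ 4 * (12 ^ 4 * 27 ^ d)"
    unfolding xd yd zd by (simp add: power_mult_distrib algebra_simps)
  then have "(27 :: 'a alg_closure) ^ 4 = 12 ^ 4 * 27 ^ d"
    using \<open>M \<noteq> 0\<close> by simp
  \<comment> \<open>The constants come from the base field, where 27^d is 1 or -1; squaring removes
    this sign.\<close>
  then have "to_ac ((27 :: 'a) ^ 4) = to_ac (12 ^ 4 * 27 ^ d)"
    by simp
  then have "((27 :: 'a) ^ 4)\<^sup>2 = (12 ^ 4 * 27 ^ d)\<^sup>2"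
    by (simp only: to_ac_eq_iff)
  moreover have "(27 :: 'a) \<noteq> 0"
    using three power_not_zero[of "3 :: 'a" 3] by simp
  then have "((27 :: 'a) ^ d)\<^sup>2 = 1"
    using power_eq_one_or_minus_one[OF card, of 27] by auto
  ultimately have "((27 :: 'a) ^ 4)\<^sup>2 = (12 ^ 4)\<^sup>2"
    by (simp only: power_mult_distrib mult_1_right)
  \<comment> \<open>27 = 3 * 9 and 12 = 3 * 4.\<close>
  then have "(3 :: 'a) ^ 8 * 9 ^ 8 = 3 ^ 8 * 4 ^ 8"
    by simp
  then have "(9 :: 'a) ^ 8 = 4 ^ 8"
    using three by (simp only: mult_cancel_left power_eq_0_iff) simp
  moreover have "t\<^sup>2 \<noteq> -1" for t :: 'a
    using minus_one_not_square[OF card d(1) two] .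
  ultimately show False
    using nine_pow8_neq_four_pow8[OF _ two] by blast
qed

section \<open>Blocking\<close>

lemma blocking_curve_blocking_poly:
  assumes card: "CARD('a::{field,finite}) = 2 * d + 1" and d: "odd d" "5 \<le> d"
  shows "blocking_curve (blocking_poly d :: 'a poly3)"
proof (rule blocking_curveI)
  show "homogeneous3 d (blocking_poly d :: 'a poly3)"
    using d by (intro homogeneous3_blocking_poly) simp
  fix l :: "'a ^ 3"
  define a b c where "a = l $ 1" and "b = l $ 2" and "c = l $ 3"
  define Z where "Z x y z \<longleftrightarrow> \<not> (x = 0 \<and> y = 0 \<and> z = 0) \<and> a * x + b * y + c * z = 0 \<and>
    x ^ d + y ^ d + z ^ d = 3 * (x\<^sup>2 * y\<^sup>2 * z ^ (d - 4))" for x y z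
  \<comment> \<open>The d-th powers are distinct signs, hence opposite, and the odd power of -1
    corrects the quotient to 1.\<close>
  have ratio: "(- u / w) ^ d = 1" if "u \<noteq> 0" "w \<noteq> 0" "u ^ d \<noteq> w ^ d" for u w :: 'a
    using power_eq_one_or_minus_one[OF card that(1)] power_eq_one_or_minus_one[OF card that(2)]
      that(3) d(1) by (auto simp: power_divide)
  have d4: "s ^ 4 * s ^ (d - 4) = s ^ d" for s :: 'a
    using d(2) by (simp flip: power_add)
  have "\<exists>x y z. Z x y z"
  proof (cases "a ^ d = b ^ d \<or> b ^ d = c ^ d \<or> c ^ d = a ^ d")
    case True
    \<comment> \<open>On a side of the triangle the mixed term vanishes, as its exponents 2, 2 and d
      - 4 are positive. The second alternative handles two zero coefficients.\<close>
    moreover have "Z b (- a) 0 \<or> Z 1 (-1) 0" if "a ^ d = b ^ d"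
      using that d by (auto simp: Z_def zero_power)
    moreover have "Z 0 c (- b) \<or> Z 0 1 (-1)" if "b ^ d = c ^ d"
      using that d by (auto simp: Z_def zero_power)
    moreover have "Z (- c) 0 a \<or> Z (-1) 0 1" if "c ^ d = a ^ d"
      using that d by (auto simp: Z_def zero_power)
    ultimately show ?thesis
      by blast
  next
    case False
    \<comment> \<open>Three nonzero coefficients would have d-th powers in {1, -1}, so two of these
      would agree.\<close>
    have "a = 0 \<or> b = 0 \<or> c = 0"
      using False power_eq_one_or_minus_one[OF card] by metis
    with False consider
        (a) "a = 0" "b \<noteq> 0" "c \<noteq> 0" "c ^ d \<noteq> b ^ d"
      | (b) "b = 0" "c \<noteq> 0" "a \<noteq> 0" "a ^ d \<noteq> c ^ d"
      | (c) "c = 0" "a \<noteq> 0" "b \<noteq> 0" "b ^ d \<noteq> a ^ d"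
      by metis
    then show ?thesis
    proof cases
      case a
      define s where "s = - c / b"
      have s: "s ^ d = 1" "s \<noteq> 0"
        using ratio[of c b] a by (auto simp: s_def)
      \<comment> \<open>The line leaves x free; x = 1/s makes x y = 1.\<close>
      then have "Z (1 / s) s 1"
        using a by (simp add: Z_def power_divide) (simp add: s_def)
      then show ?thesis by blast
    next
      case b
      define s where "s = - a / c"
      have s: "s ^ d = 1"
        using ratio[of a c] b by (auto simp: s_def)
      then have "(s\<^sup>2) ^ d = 1"
        by (metis mult.commute power_mult power_one)
      with s have "Z 1 (s\<^sup>2) s"
        using b d4[of s] by (simp add: Z_def flip: power_mult) (simp add: s_def)
      then show ?thesis by blast
    next
      case c
      define s where "s = - b / a"
      \<comment> \<open>As s^(d + 1) = s and d + 1 is even, this is a square root of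
        \<open>s\<close>.\<close>
      define r where "r = s ^ ((d + 1) div 2)"
      have s: "s ^ d = 1"
        using ratio[of b a] c by (auto simp: s_def)
      then have "r ^ d = 1"
        by (metis r_def mult.commute power_mult power_one)
      moreover have "(d + 1) div 2 * 2 = d + 1"
        using d(1) by presburger
      then have "r\<^sup>2 = s"
        using s unfolding r_def by (simp only: flip: power_mult) simp
      then have "s\<^sup>2 = r ^ 4"
        by auto
      then have "s\<^sup>2 * r ^ (d - 4) = r ^ d"
        by (simp only: d4)
      ultimately have "Z s 1 r"
        using c s by (simp add: Z_def) (simp add: s_def)
      then show ?thesis by blast
    qed
  qed
  then obtain x y z where "Z x y z" by blast
  then show "\<exists>v. v \<noteq> 0 \<and> eval3 (blocking_poly d) v = 0 \<and> (\<Sum>i\<in>UNIV. l $ i * v $ i) = 0"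
    by (intro exI[of _ "vector [x, y, z]"])
       (simp add: Z_def a_def b_def c_def eval3_blocking_poly sum_3 vec_eq_iff forall_3)
qed

theorem theorem1p9:
  fixes q :: nat
  assumes "primepow q" and "q \<ge> 11" and "q mod 4 = 3"
    and "CARD('a::{field,finite}) = q" and "CHAR('a) > 3"
  shows "\<exists>F :: 'a poly3. plane_curve ((q - 1) div 2) F \<and> smooth_curve F \<and> blocking_curve F"
proof -
  define d where "d = (q - 1) div 2"
  \<comment> \<open>q = 4 k + 3 gives d = 2 k + 1, and q \<ge> 11 gives k \<ge> 2.\<close>
  have "q = 2 * d + 1" "odd d" "5 \<le> d"
    using assms(2,3) unfolding d_def by presburger+
  then have "plane_curve d (blocking_poly d :: 'a poly3)"
    "smooth_curve (blocking_poly d :: 'a poly3)" "blocking_curve (blocking_poly d :: 'a poly3)"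
    using assms(4,5)
    by (auto intro: plane_curve_blocking_poly smooth_curve_blocking_poly blocking_curve_blocking_poly)
  then show ?thesis
    unfolding d_def by blast
qed

end
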